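(* Let $\mathbf a$ be a non-empty admissible composition of weight $k$, and let $\varepsilon_1\ldots\varepsilon_k$ be its associated binary word $\mathbf w(\mathbf a)$. For $1\leqslant i\leqslant k-1$, let $\mathbf a_i$ denote the composition whose associated binary word is $\varepsilon_{i+1}\ldots\varepsilon_k$, and let $\overline{\mathbf a}_{k-i}$ denote the composition whose associated binary word is $\overline{\varepsilon_i}\ldots\overline{\varepsilon_1}$ (where $\overline{0}=1$, $\overline{1}=0$). Then $$\delta([\mathbf a])=\sum_{i=1}^{k-1}(1+\overline{\varepsilon_i}+\varepsilon_{i+1})\;\overline{\mathbf a}_{k-i}\mathbin{\boxed{\ast}}\mathbf a_i .$$
   Context: A composition is a finite sequence $\mathbf a=(a_1,\ldots,a_r)$ of positive integers; its weight is $a_1+\cdots+a_r$ and its depth is $r$. It is admissible if it is empty or $a_1\geqslant 2$. Its associated binary word is $\mathbf w(\mathbf a)=\{0\}_{a_1-1}1\ldots\{0\}_{a_r-1}1$, where $\{0\}_u$ is the word of $u$ zeros; $\mathbf w$ is a bijection from compositions to binary words not ending in $0$. The dual of a binary word $\varepsilon_1\ldots\varepsilon_k$ is $\overline{\varepsilon_k}\ldots\overline{\varepsilon_1}$; the dual $\overline{\mathbf a}$ of an admissible composition $\mathbf a$ is the admissible composition whose word is dual to $\mathbf w(\mathbf a)$. Let $\mathcal A$ be the set of admissible compositions, $\mathcal B$ the set of classes $[\mathbf a]=\{\mathbf a,\overline{\mathbf a}\}$. For $\mathbf a=(a_1,\ldots,a_r)$, $\mathbf a^{\rm init}=(a_1,\ldots,a_{r-1})$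 (and $\varnothing^{\rm init}=\varnothing$); for admissible $\mathbf a$, $\mathbf a^{\rm fin}$ is the dual of $(\overline{\mathbf a})^{\rm init}$ and $\mathbf a^{\rm mid}=(\mathbf a^{\rm fin})^{\rm init}$. The map $\delta:\mathbf Z^{(\mathcal B)}\to\mathbf Z^{(\mathcal A)}$ is the unique $\mathbf Z$-linear map, graded of degree $0$ for the weight, such that $\delta([\varnothing])=\varnothing$ and $\delta([\mathbf a])^{\rm init}=\delta([\mathbf a^{\rm init}]+[\mathbf a^{\rm mid}]+[\mathbf a^{\rm fin}])$ for every non-empty admissible $\mathbf a$ (where ${}^{\rm init}$ is extended $\mathbf Z$-linearly); equivalently, $\delta(\ell)$ is the unique element $\sum\lambda_{\mathbf b}\mathbf b$ with $\zeta(\ell)_{n,n}=\sum\lambda_{\mathbf b}\sigma(\mathbf b)_n$ for all $n\geqslant0$. The stuffle product $\ast$ on $\mathbf Z$-linear combinations of compositions: a stuffling of $r,s$ is $(t,I,J)$ with $|I|=r$, $|J|=s$, $I\cup J=\{1,\ldots,t\}$; the composition $\mathbf c=(c_1,\ldots,c_t)$ deduced from $\mathbf a=(a_1,\ldots,a_r)$, $\mathbf b=(b_1,\ldots,b_s)$ has $c_i=a_{\sigma_I(i)}$, $b_{\sigma_J(i)}$, or $a_{\sigma_I(i)}+b_{\sigma_J(i)}$ according as $i$ lies in $I$ only, $J$ only, or both ($\sigma_I,\sigma_J$ the increasing bijections onto $\{1,\ldots,r\}$, $\{1,\ldots,s\}$); $\mathbf a\ast\mathbf b$ is the sum over all stufflings.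 The modified stuffle product $\mathbin{\boxed{\ast}}$ on non-empty compositions is the bilinear law: if $(a_2,\ldots,a_r)\ast(b_2,\ldots,b_s)=\sum_{\mathbf c}\lambda_{\mathbf c}\mathbf c$, then $(a_1,\ldots,a_r)\mathbin{\boxed{\ast}}(b_1,\ldots,b_s)=\sum_{\mathbf c}\lambda_{\mathbf c}(a_1+b_1,\mathbf c)$ (add first entries, stuffle the rest). *)

theory Defs
  imports "HOL-Algebra.Free_Abelian_Groups"
begin

section \<open>Compositions and binary words\<close>

definition composition :: "nat list \<Rightarrow> bool" where
  "composition a \<longleftrightarrow> (\<forall>m\<in>set a. 0 < m)"

abbreviation weight :: "nat list \<Rightarrow> nat" where
  "weight a \<equiv> sum_list a"

definition admissible :: "nat list \<Rightarrow> bool" where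
  "admissible a \<longleftrightarrow> composition a \<and> (a = [] \<or> 2 \<le> hd a)"

text \<open>Binary words are Boolean lists, with \<^term>\<open>True\<close> for the letter 1 and \<^term>\<open>False\<close> for 0.\<close>

definition word :: "nat list \<Rightarrow> bool list" where
  "word a = concat (map (\<lambda>m. replicate (m - 1) False @ [True]) a)"

definition comp_of_word :: "bool list \<Rightarrow> nat list" where
  "comp_of_word = the_inv_into {a. composition a} word"

definition dual_word :: "bool list \<Rightarrow> bool list" where
  "dual_word w = rev (map Not w)"

definition dual :: "nat list \<Rightarrow> nat list" where
  "dual a = comp_of_word (dual_word (word a))"

definition dual_class :: "nat list \<Rightarrow> nat list set" where
  "dual_class a = {a, dual a}"

abbreviation init :: "nat list \<Rightarrow> nat list" where
  "init a \<equiv> butlast a"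

definition fin :: "nat list \<Rightarrow> nat list" where
  "fin a = dual (init (dual a))"

definition mid :: "nat list \<Rightarrow> nat list" where
  "mid a = init (fin a)"


section \<open>The map delta\<close>

definition adm_comps :: "nat list set" where
  "adm_comps = {a. admissible a}"

definition adm_classes :: "nat list set set" where
  "adm_classes = dual_class ` adm_comps"

definition adm_comps_wt :: "nat \<Rightarrow> nat list set" where
  "adm_comps_wt k = {a \<in> adm_comps. weight a = k}"

definition adm_classes_wt :: "nat \<Rightarrow> nat list set set" where
  "adm_classes_wt k = dual_class ` adm_comps_wt k"

definition init_lin :: "(nat list \<Rightarrow>\<^sub>0 int) \<Rightarrow> (nat list \<Rightarrow>\<^sub>0 int)" where
  "init_lin = frag_extend (\<lambda>a. frag_of (init a))"

text \<open>A \<open>\<int>\<close>-linear map is a homomorphism between the free Abelian groups. The extensionality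
  condition fixes its (irrelevant) values outside of the domain, so that it is unique.\<close>

definition is_delta :: "((nat list set \<Rightarrow>\<^sub>0 int) \<Rightarrow> (nat list \<Rightarrow>\<^sub>0 int)) \<Rightarrow> bool" where
  "is_delta d \<longleftrightarrow>
     d \<in> hom (free_Abelian_group adm_classes) (free_Abelian_group adm_comps) \<and>
     d \<in> extensional (carrier (free_Abelian_group adm_classes)) \<and>
     (\<forall>k. d ` carrier (free_Abelian_group (adm_classes_wt k))
          \<subseteq> carrier (free_Abelian_group (adm_comps_wt k))) \<and>
     d (frag_of (dual_class [])) = frag_of [] \<and>
     (\<forall>a. admissible a \<and> a \<noteq> [] \<longrightarrow>
        init_lin (d (frag_of (dual_class a))) =
        d (frag_of (dual_class (init a)) + frag_of (dual_class (mid a)) + frag_of (dual_class (fin a))))"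

definition delta :: "(nat list set \<Rightarrow>\<^sub>0 int) \<Rightarrow> (nat list \<Rightarrow>\<^sub>0 int)" where
  "delta = (THE d. is_delta d)"


section \<open>Stuffle products\<close>

definition stufflings :: "nat \<Rightarrow> nat \<Rightarrow> (nat \<times> nat set \<times> nat set) set" where
  "stufflings r s = {(t, I, J). card I = r \<and> card J = s \<and> I \<union> J = {1..t}}"

text \<open>On \<open>I\<close>, this is the increasing bijection from \<open>I\<close> onto \<open>{1..card I}\<close>.\<close>

definition rank :: "nat set \<Rightarrow> nat \<Rightarrow> nat" where
  "rank I i = card {j \<in> I. j \<le> i}"

text \<open>List positions start at 0, hence the subtractions of 1.\<close>

definition stuffled :: "nat list \<Rightarrow> nat list \<Rightarrow> nat \<times> nat set \<times> nat set \<Rightarrow> nat list" where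
  "stuffled a b = (\<lambda>(t, I, J). map (\<lambda>i.
      if i \<in> I \<and> i \<in> J then a ! (rank I i - 1) + b ! (rank J i - 1)
      else if i \<in> I then a ! (rank I i - 1)
      else b ! (rank J i - 1)) [1..<Suc t])"

definition stuffle :: "nat list \<Rightarrow> nat list \<Rightarrow> (nat list \<Rightarrow>\<^sub>0 int)" where
  "stuffle a b = (\<Sum>p\<in>stufflings (length a) (length b). frag_of (stuffled a b p))"

text \<open>The modified product is only meaningful on combinations of non-empty compositions.\<close>

definition box_stuffle_basis :: "nat list \<Rightarrow> nat list \<Rightarrow> (nat list \<Rightarrow>\<^sub>0 int)" where
  "box_stuffle_basis a b = frag_extend (\<lambda>c. frag_of ((hd a + hd b) # c)) (stuffle (tl a) (tl b))"

definition box_stuffle ::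
    "(nat list \<Rightarrow>\<^sub>0 int) \<Rightarrow> (nat list \<Rightarrow>\<^sub>0 int) \<Rightarrow> (nat list \<Rightarrow>\<^sub>0 int)"  (infixl \<open>\<boxtimes>\<close> 70) where
  "x \<boxtimes> y = frag_extend (\<lambda>a. frag_extend (\<lambda>b. box_stuffle_basis a b) y) x"


section \<open>Well-definedness\<close>

lemma finite_stufflings: "finite (stufflings r s)"
proof -
  have "stufflings r s \<subseteq> {..r+s} \<times> Pow {1..r+s} \<times> Pow {1..r+s}"
  proof (clarsimp simp: stufflings_def)
    fix t I J assume *: "I \<union> J = {Suc 0..t}"
    have "t = card (I \<union> J)" by (simp add: *)
    also have "\<dots> \<le> card I + card J" by (rule card_Un_le)
    finally have t: "t \<le> card I + card J" .
    have "I \<union> J \<subseteq> {Suc 0..card I + card J}" unfolding * using t by auto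
    with t show "t \<le> card I + card J \<and> I \<subseteq> {Suc 0..card I + card J} \<and> J \<subseteq> {Suc 0..card I + card J}"
      by blast
  qed
  then show ?thesis by (rule finite_subset) auto
qed

lemma rank_strict_mono:
  assumes "finite I" shows "strict_mono_on I (rank I)"
proof (rule strict_mono_onI)
  fix r s assume "r \<in> I" "s \<in> I" "r < s"
  then have "s \<in> {j \<in> I. j \<le> s}" "s \<notin> {j \<in> I. j \<le> r}" "{j \<in> I. j \<le> r} \<subseteq> {j \<in> I. j \<le> s}"
    by auto
  then have "{j \<in> I. j \<le> r} \<subset> {j \<in> I. j \<le> s}" by blast
  then show "rank I r < rank I s" unfolding rank_def by (rule psubset_card_mono[rotated]) (use assms in simp)
qed

lemma rank_bij_betw:
  assumes "finite I" shows "bij_betw (rank I) I {1..card I}"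
proof -
  have inj: "inj_on (rank I) I"
    using rank_strict_mono[OF assms] by (rule strict_mono_on_imp_inj_on)
  have "rank I i \<in> {1..card I}" if "i \<in> I" for i
  proof -
    have "rank I i \<le> card I" unfolding rank_def by (rule card_mono) (use assms in auto)
    moreover have "{j \<in> I. j \<le> i} \<noteq> {}" using that by auto
    then have "rank I i \<noteq> 0" unfolding rank_def using assms by simp
    ultimately show ?thesis by simp
  qed
  then have "rank I ` I \<subseteq> {1..card I}" by blast
  moreover have "card (rank I ` I) = card {1..card I}" using inj by (simp add: card_image)
  ultimately have "rank I ` I = {1..card I}" by (intro card_subset_eq) auto
  with inj show ?thesis by (simp add: bij_betw_def)
qed

lemma composition_simps [simp]:
  "composition []" "composition (m # a) \<longleftrightarrow> 0 < m \<and> composition a"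
  "composition (a @ b) \<longleftrightarrow> composition a \<and> composition b"
  by (auto simp: composition_def)

lemma word_simps [simp]:
  "word [] = []" "word (m # a) = replicate (m - 1) False @ True # word a"
  "word (a @ b) = word a @ word b"
  by (auto simp: word_def)

lemma length_word: "composition a \<Longrightarrow> length (word a) = weight a"
  by (induction a) auto

lemma word_eq_Nil [simp]: "word a = [] \<longleftrightarrow> a = []"
  by (cases a) auto

lemma last_word: "a \<noteq> [] \<Longrightarrow> last (word a)"
  by (induction a) auto

lemma replicate_False_True_eq:
  "replicate m False @ True # u = replicate n False @ True # v \<longleftrightarrow> m = n \<and> u = v"
proof (induction m arbitrary: n)
  case 0 then show ?case by (cases n) auto
next
  case (Suc m) then show ?case by (cases n) auto
qed

lemma word_inj: "composition a \<Longrightarrow> composition b \<Longrightarrow> word a = word b \<Longrightarrow> a = b"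
proof (induction a arbitrary: b)
  case Nil then show ?case by (metis word_eq_Nil word_simps(1))
next
  case (Cons m a)
  then show ?case by (cases b) (auto simp: replicate_False_True_eq)
qed

lemma word_surj: "u = [] \<or> last u \<Longrightarrow> \<exists>a. composition a \<and> word a = u"
proof (induction u)
  case Nil then show ?case by (intro exI[of _ "[]"]) simp
next
  case (Cons e u)
  then obtain a where a: "composition a" "word a = u" by (auto split: if_splits)
  show ?case
  proof (cases e)
    case True then show ?thesis using a by (intro exI[of _ "1 # a"]) simp
  next
    case False
    then have "a \<noteq> []" using Cons.prems a by auto
    then obtain m b where b: "a = m # b" by (cases a) auto
    then show ?thesis using a False
      by (intro exI[of _ "Suc m # b"]) (cases m; auto)
  qed
qed

lemma bij_betw_word: "bij_betw word {a. composition a} {u. u = [] \<or> last u}"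
proof (rule bij_betw_imageI)
  show "inj_on word {a. composition a}" by (rule inj_onI) (simp add: word_inj)
  show "word ` {a. composition a} = {u. u = [] \<or> last u}"
  proof (intro Set.set_eqI iffI)
    fix u assume "u \<in> word ` {a. composition a}"
    then obtain a where "u = word a" by blast
    then show "u \<in> {u. u = [] \<or> last u}" using last_word[of a] by auto
  next
    fix u :: "bool list" assume "u \<in> {u. u = [] \<or> last u}"
    then obtain a where "composition a" "word a = u" using word_surj[of u] by auto
    then show "u \<in> word ` {a. composition a}" by blast
  qed
qed

lemma comp_of_word:
  assumes "u = [] \<or> last u"
  shows "composition (comp_of_word u)" "word (comp_of_word u) = u"
proof -
  have inj: "inj_on word {a. composition a}" and img: "u \<in> word ` {a. composition a}"
    using bij_betw_word assms by (auto simp: bij_betw_def)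
  show "composition (comp_of_word u)"
    using the_inv_into_into[OF inj img subset_refl] by (simp add: comp_of_word_def)
  show "word (comp_of_word u) = u"
    using f_the_inv_into_f[OF inj img] by (simp add: comp_of_word_def)
qed

lemma comp_of_word_word [simp]: "composition a \<Longrightarrow> comp_of_word (word a) = a"
  unfolding comp_of_word_def
  using bij_betw_word by (intro the_inv_into_f_f) (auto simp: bij_betw_def)

lemma hd_word: "composition a \<Longrightarrow> a \<noteq> [] \<Longrightarrow> hd (word a) \<longleftrightarrow> hd a = 1"
  by (cases a; cases "hd a - 1") auto

lemma admissible_iff_word:
  "admissible a \<longleftrightarrow> composition a \<and> (a = [] \<or> \<not> hd (word a))"
proof -
  have "2 \<le> hd a \<longleftrightarrow> \<not> hd (word a)" if "composition a" "a \<noteq> []"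
  proof -
    have "hd a > 0" using that by (cases a) auto
    then show ?thesis using hd_word[OF that] by auto
  qed
  then show ?thesis by (auto simp: admissible_def)
qed

lemma dual_word_dual_word [simp]: "dual_word (dual_word w) = w"
  by (simp add: dual_word_def rev_map comp_def)

lemma dual_props:
  assumes "admissible a"
  shows "word (dual a) = dual_word (word a)" "admissible (dual a)"
    "dual (dual a) = a" "weight (dual a) = weight a"
proof -
  have *: "dual_word (word a) = [] \<or> last (dual_word (word a))"
    using assms by (cases "a = []") (simp_all add: admissible_iff_word dual_word_def last_rev hd_map)
  show w: "word (dual a) = dual_word (word a)"
    using comp_of_word[OF *] by (simp add: dual_def)
  have c: "composition (dual a)" using comp_of_word[OF *] by (simp add: dual_def)
  have "dual a = [] \<or> \<not> hd (word (dual a))"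
  proof (cases "a = []")
    case True
    then show ?thesis by (metis w word_eq_Nil dual_word_def list.simps(8) rev.simps(1))
  next
    case False
    then show ?thesis using last_word[of a] by (simp add: w dual_word_def hd_rev last_map)
  qed
  with c show "admissible (dual a)" by (simp add: admissible_iff_word)
  show "dual (dual a) = a"
    unfolding dual_def[of "dual a"] w using assms by (simp add: admissible_iff_word)
  have "composition a" using assms by (simp add: admissible_def)
  then show "weight (dual a) = weight a"
    using length_word[OF c] length_word[of a] by (simp add: w dual_word_def)
qed

lemma dual_Nil [simp]: "dual [] = []"
  using comp_of_word_word[of "[]"] by (simp add: dual_def dual_word_def)

lemma admissible_Nil [simp]: "admissible []"
  by (simp add: admissible_def)

lemma admissible_init: "admissible a \<Longrightarrow> admissible (init a)"
  by (cases a rule: rev_cases) (auto simp: admissible_def hd_append split: if_splits)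

lemma weight_init: "admissible a \<Longrightarrow> a \<noteq> [] \<Longrightarrow> weight (init a) < weight a"
  by (cases a rule: rev_cases) (auto simp: admissible_def)

lemma dual_eq_Nil: "admissible a \<Longrightarrow> dual a = [] \<longleftrightarrow> a = []"
  using dual_props(3) by force

lemma admissible_fin: "admissible a \<Longrightarrow> admissible (fin a)"
  by (simp add: fin_def admissible_init dual_props)

lemma weight_fin: "admissible a \<Longrightarrow> a \<noteq> [] \<Longrightarrow> weight (fin a) < weight a"
  by (metis admissible_init dual_eq_Nil dual_props(2,4) fin_def weight_init)

lemma admissible_mid: "admissible a \<Longrightarrow> admissible (mid a)"
  by (simp add: mid_def admissible_init admissible_fin)

lemma weight_mid: "admissible a \<Longrightarrow> a \<noteq> [] \<Longrightarrow> weight (mid a) < weight a"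
proof -
  assume a: "admissible a" "a \<noteq> []"
  have "weight (mid a) \<le> weight (fin a)"
    using weight_init[OF admissible_fin[OF a(1)]] by (cases "fin a = []") (auto simp: mid_def)
  with weight_fin[OF a] show ?thesis by simp
qed

lemma weight_ge_2: "admissible a \<Longrightarrow> a \<noteq> [] \<Longrightarrow> 2 \<le> weight a"
  by (cases a) (auto simp: admissible_def)

definition init_word :: "bool list \<Rightarrow> bool list" where
  "init_word w = rev (dropWhile Not (tl (rev w)))"

definition fin_word :: "bool list \<Rightarrow> bool list" where
  "fin_word w = dropWhile (\<lambda>e. e) (tl w)"

lemma word_init: "word (init a) = init_word (word a)"
proof (cases a rule: rev_cases)
  case Nil then show ?thesis by (simp add: init_word_def)
next
  case (snoc b m)
  have "dropWhile Not (rev (word b)) = rev (word b)"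
    using last_word[of b] by (cases b rule: rev_cases) auto
  moreover have "dropWhile Not (replicate n False @ u) = dropWhile Not u" for n u
    by (induction n) auto
  ultimately show ?thesis by (simp add: snoc init_word_def)
qed

lemma fin_word_dual: "dual_word (init_word (dual_word w)) = fin_word w"
proof -
  have "map Not (dropWhile Not (map Not v)) = dropWhile (\<lambda>e. e) v" for v
    by (induction v) (auto simp: comp_def)
  then show ?thesis by (simp add: dual_word_def init_word_def fin_word_def rev_map map_tl[symmetric] comp_def)
qed

lemma word_fin: "admissible a \<Longrightarrow> word (fin a) = fin_word (word a)"
  by (simp add: fin_def dual_props admissible_init word_init fin_word_dual)

lemma fin_word_replicate: "fin_word (False # replicate n True @ u) = dropWhile (\<lambda>e. e) u"
  by (induction n) (auto simp: fin_word_def)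

lemma init_word_append:
  assumes "x \<noteq> []"
  shows "init_word (u @ x) =
    (if init_word x = [] then rev (dropWhile Not (rev u)) else u @ init_word x)"
proof -
  have "dropWhile Not (y @ rev u) =
      (if dropWhile Not y = [] then dropWhile Not (rev u) else dropWhile Not y @ rev u)" for y
    by (induction y) auto
  note * = this[of "tl (rev x)"]
  have "tl (rev (u @ x)) = tl (rev x) @ rev u" using assms by simp
  then have "init_word (u @ x) = rev (if dropWhile Not (tl (rev x)) = [] then dropWhile Not (rev u)
      else dropWhile Not (tl (rev x)) @ rev u)"
    unfolding init_word_def using * by (simp only:)
  then show ?thesis
    unfolding init_word_def by (cases "dropWhile Not (tl (rev x)) = []")
      (simp_all only: if_True if_False rev_is_Nil_conv rev_append rev_rev_ident simp_thms)
qed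

lemma fin_word_init_word:
  assumes "\<not> hd w" "last w" "w \<noteq> []"
  shows "fin_word (init_word w) = init_word (fin_word w)"
proof -
  obtain v where w: "w = False # v" using assms by (cases w) auto
  define n where "n = length (takeWhile (\<lambda>e. e) v)"
  define u where "u = dropWhile (\<lambda>e. e) v"
  have tw: "takeWhile (\<lambda>e. e) v = replicate n True"
    unfolding n_def by (induction v) auto
  have wu: "w = False # replicate n True @ u"
    unfolding w u_def tw[symmetric] by simp
  have u_hd: "u = [] \<or> \<not> hd u" unfolding u_def using hd_dropWhile[of "\<lambda>e. e" v] by blast
  have fw: "fin_word w = u"
    unfolding wu fin_word_replicate u_def by simp
  have rep: "rev (dropWhile Not (replicate m True @ [False])) =
      (if m = 0 then [] else False # replicate m True)" for m
    by (cases m) (auto simp: replicate_append_same)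
  have finrep: "fin_word (if m = 0 then [] else False # replicate m True) = []" for m
    using fin_word_replicate[of m "[]"] by (simp add: fin_word_def)
  show ?thesis
  proof (cases "u = []")
    case True
    then have "n \<noteq> 0" using assms(2) by (intro notI) (simp add: wu)
    then obtain m where m: "n = Suc m" by (cases n) auto
    have "init_word w = (if m = 0 then [] else False # replicate m True)"
    proof -
      have "rev w = rev (replicate (Suc m) True) @ [False]" by (simp add: wu True m)
      then have "tl (rev w) = replicate m True @ [False]" by (simp only: rev_replicate) simp
      then show ?thesis using rep[of m] by (simp only: init_word_def)
    qed
    then have "fin_word (init_word w) = []" using finrep[of m] by simp
    then show ?thesis by (simp add: fw True init_word_def)
  next
    case False
    have iw: "init_word w = (if init_word u = [] then rev (dropWhile Not (replicate n True @ [False]))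
        else False # replicate n True @ init_word u)"
      using init_word_append[OF False, of "False # replicate n True"] by (simp add: wu)
    show ?thesis
    proof (cases "init_word u = []")
      case True
      then have "fin_word (init_word w) = []" using iw rep[of n] finrep[of n] by simp
      then show ?thesis by (simp add: fw True)
    next
      case ne: False
      obtain x where x: "u = False # x" using False u_hd by (cases u) auto
      have "x \<noteq> []" using ne x by (auto simp: init_word_def)
      then have "\<not> hd (init_word u)"
        using init_word_append[of x "[False]"] ne by (simp add: x split: if_splits)
      then have "dropWhile (\<lambda>e. e) (init_word u) = init_word u"
        by (cases "init_word u") auto
      then show ?thesis using iw ne fw fin_word_replicate[of n "init_word u"] by simp
    qed
  qed
qed

lemma fin_init: "admissible a \<Longrightarrow> fin (init a) = init (fin a)"
proof -
  assume a: "admissible a"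
  have "word (fin (init a)) = word (init (fin a))"
  proof (cases "a = []")
    case True then show ?thesis by (simp add: fin_def)
  next
    case False
    then show ?thesis
      using a by (simp add: word_fin word_init admissible_init fin_word_init_word
          admissible_iff_word[of a] last_word)
  qed
  then show ?thesis
    using a admissible_fin admissible_init admissible_def word_inj by metis
qed

lemma init_dual: "admissible a \<Longrightarrow> init (dual a) = dual (fin a)"
  by (simp add: fin_def dual_props admissible_init)

lemma fin_dual: "admissible a \<Longrightarrow> fin (dual a) = dual (init a)"
  by (simp add: fin_def dual_props)

lemma mid_dual: "admissible a \<Longrightarrow> mid (dual a) = dual (mid a)"
  by (simp add: mid_def fin_dual init_dual admissible_init fin_init)

lemma dual_class_dual: "admissible a \<Longrightarrow> dual_class (dual a) = dual_class a"
  by (auto simp: dual_class_def dual_props)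

definition complete_lin :: "nat \<Rightarrow> (nat list \<Rightarrow>\<^sub>0 int) \<Rightarrow> (nat list \<Rightarrow>\<^sub>0 int)" where
  "complete_lin k = frag_extend (\<lambda>a. frag_of (a @ [k - weight a]))"

lemma frag_extend_cong_keys:
  "(\<And>x. x \<in> Poly_Mapping.keys c \<Longrightarrow> f x = g x) \<Longrightarrow> frag_extend f c = frag_extend g c"
  by (simp add: frag_extend_def)

lemma frag_extend_compose_of:
  "frag_extend g (frag_extend (\<lambda>x. frag_of (f x)) c) = frag_extend (\<lambda>x. g (f x)) c"
  using frag_extend_compose[of g "f" c] by (simp add: comp_def)

lemma frag_extend_id:
  assumes "\<And>x. x \<in> Poly_Mapping.keys c \<Longrightarrow> f x = frag_of x"
  shows "frag_extend f c = c"
  using frag_extend_cong_keys[OF assms] frag_expansion[of c, symmetric] by (rule trans)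

lemma complete_init:
  assumes "Poly_Mapping.keys c \<subseteq> adm_comps_wt k" "k \<noteq> 0"
  shows "complete_lin k (init_lin c) = c"
  unfolding complete_lin_def init_lin_def frag_extend_compose_of
proof (rule frag_extend_id)
  fix a assume "a \<in> Poly_Mapping.keys c"
  then have "weight a = k" using assms by (auto simp: adm_comps_wt_def)
  then show "frag_of (init a @ [k - weight (init a)]) = frag_of a"
    using assms(2) by (cases a rule: rev_cases) auto
qed

lemma init_complete: "init_lin (complete_lin k c) = c"
  unfolding complete_lin_def init_lin_def frag_extend_compose_of
  by (rule frag_extend_id) simp

lemma keys_complete:
  assumes "\<And>a. a \<in> Poly_Mapping.keys c \<Longrightarrow> admissible a \<and> weight a < k" "2 \<le> k"
  shows "Poly_Mapping.keys (complete_lin k c) \<subseteq> adm_comps_wt k"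
proof
  fix b assume "b \<in> Poly_Mapping.keys (complete_lin k c)"
  then obtain a where "a \<in> Poly_Mapping.keys c" "b = a @ [k - weight a]"
    using keys_frag_extend[of "\<lambda>a. frag_of (a @ [k - weight a])" c]
    by (auto simp: complete_lin_def)
  moreover from this(1) have "admissible a" "weight a < k" using assms(1) by auto
  ultimately show "b \<in> adm_comps_wt k"
    using assms(2) by (cases a) (auto simp: adm_comps_wt_def adm_comps_def admissible_def)
qed

function delta_rec :: "nat list \<Rightarrow> (nat list \<Rightarrow>\<^sub>0 int)" where
  "delta_rec a = (if admissible a \<and> a \<noteq> [] then
      complete_lin (weight a) (delta_rec (init a) + delta_rec (mid a) + delta_rec (fin a))
    else frag_of [])"
  by auto
termination
  by (relation "measure weight") (auto simp: weight_init weight_mid weight_fin)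

declare delta_rec.simps [simp del]

lemma keys_delta_rec:
  "admissible a \<Longrightarrow> Poly_Mapping.keys (delta_rec a) \<subseteq> adm_comps_wt (weight a)"
proof (induction "weight a" arbitrary: a rule: less_induct)
  case less
  show ?case
  proof (cases "a = []")
    case True then show ?thesis by (simp add: delta_rec.simps adm_comps_wt_def adm_comps_def)
  next
    case False
    have "b \<in> Poly_Mapping.keys (delta_rec (init a) + delta_rec (mid a) + delta_rec (fin a)) \<Longrightarrow>
        admissible b \<and> weight b < weight a" for b
    proof -
      assume b: "b \<in> Poly_Mapping.keys (delta_rec (init a) + delta_rec (mid a) + delta_rec (fin a))"
      have "b \<in> Poly_Mapping.keys (delta_rec (init a)) \<union> Poly_Mapping.keys (delta_rec (mid a))
          \<union> Poly_Mapping.keys (delta_rec (fin a))"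
        using subsetD[OF Poly_Mapping.keys_add b]
          subsetD[OF Poly_Mapping.keys_add[of "delta_rec (init a)" "delta_rec (mid a)"], of b] by auto
      then have "b \<in> adm_comps_wt (weight (init a)) \<union> adm_comps_wt (weight (mid a))
          \<union> adm_comps_wt (weight (fin a))"
        using less.hyps[OF weight_init[OF less.prems False] admissible_init[OF less.prems]]
          less.hyps[OF weight_mid[OF less.prems False] admissible_mid[OF less.prems]]
          less.hyps[OF weight_fin[OF less.prems False] admissible_fin[OF less.prems]]
        by blast
      then show ?thesis
        using weight_init[OF less.prems False] weight_mid[OF less.prems False]
          weight_fin[OF less.prems False]
        by (auto simp: adm_comps_wt_def adm_comps_def)
    qed
    from keys_complete[OF this weight_ge_2[OF less.prems False]]
    show ?thesis using False less.prems by (simp add: delta_rec.simps[of a])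
  qed
qed

lemma delta_rec_dual: "admissible a \<Longrightarrow> delta_rec (dual a) = delta_rec a"
proof (induction "weight a" arbitrary: a rule: less_induct)
  case less
  show ?case
  proof (cases "a = []")
    case False
    show ?thesis
      using less.prems False
        less.hyps[OF weight_init[OF less.prems False] admissible_init[OF less.prems]]
        less.hyps[OF weight_mid[OF less.prems False] admissible_mid[OF less.prems]]
        less.hyps[OF weight_fin[OF less.prems False] admissible_fin[OF less.prems]]
      by (simp add: delta_rec.simps[of a] delta_rec.simps[of "dual a"] dual_props dual_eq_Nil
          init_dual mid_dual fin_dual add_ac)
  qed simp
qed

definition delta_witness :: "(nat list set \<Rightarrow>\<^sub>0 int) \<Rightarrow> (nat list \<Rightarrow>\<^sub>0 int)" where
  "delta_witness = restrict (frag_extend (\<lambda>X. delta_rec (SOME a. a \<in> X)))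
     (carrier (free_Abelian_group adm_classes))"

lemma dual_class_mem: "admissible a \<Longrightarrow> dual_class a \<in> adm_classes"
  by (simp add: adm_classes_def adm_comps_def)

lemma delta_rec_some: "admissible a \<Longrightarrow> delta_rec (SOME b. b \<in> dual_class a) = delta_rec a"
proof -
  assume a: "admissible a"
  have "(SOME b. b \<in> dual_class a) \<in> dual_class a"
    by (rule someI[of _ a]) (simp add: dual_class_def)
  then show ?thesis using a delta_rec_dual by (auto simp: dual_class_def)
qed

lemma delta_witness_of: "admissible a \<Longrightarrow> delta_witness (frag_of (dual_class a)) = delta_rec a"
  by (simp add: delta_witness_def dual_class_mem delta_rec_some)

lemma keys_delta_ext:
  assumes "Poly_Mapping.keys c \<subseteq> dual_class ` S" "\<And>a. a \<in> S \<Longrightarrow> admissible a"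
    "\<And>a. a \<in> S \<Longrightarrow> adm_comps_wt (weight a) \<subseteq> T"
  shows "Poly_Mapping.keys (frag_extend (\<lambda>X. delta_rec (SOME a. a \<in> X)) c) \<subseteq> T"
proof
  fix b assume "b \<in> Poly_Mapping.keys (frag_extend (\<lambda>X. delta_rec (SOME a. a \<in> X)) c)"
  then obtain X where X: "X \<in> Poly_Mapping.keys c"
      "b \<in> Poly_Mapping.keys (delta_rec (SOME a. a \<in> X))"
    using keys_frag_extend[of "\<lambda>X. delta_rec (SOME a. a \<in> X)" c] by blast
  then obtain a where "a \<in> S" "X = dual_class a" using assms by blast
  with X assms(2,3) keys_delta_rec[of a] delta_rec_some[of a] show "b \<in> T" by fastforce
qed

lemma adm_classes_wt_subset: "adm_classes_wt k \<subseteq> adm_classes"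
  by (auto simp: adm_classes_wt_def adm_classes_def adm_comps_wt_def)

lemma is_delta_witness: "is_delta delta_witness"
  unfolding is_delta_def
proof (intro conjI allI impI)
  let ?G = "free_Abelian_group adm_classes"
  let ?f = "frag_extend (\<lambda>X. delta_rec (SOME a. a \<in> X))"
  have add: "delta_witness (x + y) = delta_witness x + delta_witness y"
    if "x \<in> carrier ?G" "y \<in> carrier ?G" for x y
  proof -
    have "x + y \<in> carrier ?G" using that Poly_Mapping.keys_add[of x y] by auto
    then show ?thesis using that by (simp add: delta_witness_def frag_extend_add)
  qed
  show "delta_witness \<in> hom ?G (free_Abelian_group adm_comps)"
  proof (rule homI)
    fix x assume x: "x \<in> carrier ?G"
    have "Poly_Mapping.keys (?f x) \<subseteq> adm_comps"
      by (rule keys_delta_ext[of x adm_comps])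
        (use x in \<open>auto simp: adm_classes_def adm_comps_def adm_comps_wt_def\<close>)
    then show "delta_witness x \<in> carrier (free_Abelian_group adm_comps)"
      using x by (simp add: delta_witness_def)
  qed (use add in simp)
  show "delta_witness \<in> extensional (carrier ?G)" by (simp add: delta_witness_def)
  show "delta_witness ` carrier (free_Abelian_group (adm_classes_wt k))
          \<subseteq> carrier (free_Abelian_group (adm_comps_wt k))" for k
  proof
    fix y assume "y \<in> delta_witness ` carrier (free_Abelian_group (adm_classes_wt k))"
    then obtain x where x: "Poly_Mapping.keys x \<subseteq> adm_classes_wt k" "y = delta_witness x" by auto
    have "Poly_Mapping.keys (?f x) \<subseteq> adm_comps_wt k"
      by (rule keys_delta_ext[of x "adm_comps_wt k"])
        (use x in \<open>auto simp: adm_classes_wt_def adm_comps_def adm_comps_wt_def\<close>)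
    moreover have "y = ?f x"
      using x adm_classes_wt_subset[of k] by (auto simp: delta_witness_def)
    ultimately show "y \<in> carrier (free_Abelian_group (adm_comps_wt k))" by simp
  qed
  show "delta_witness (frag_of (dual_class [])) = frag_of []"
    by (simp add: delta_witness_of delta_rec.simps)
  fix a assume a: "admissible a \<and> a \<noteq> []"
  have mem: "frag_of (dual_class b) \<in> carrier ?G" if "admissible b" for b
    using that by (simp add: dual_class_mem)
  have mem2: "frag_of (dual_class (init a)) + frag_of (dual_class (mid a)) \<in> carrier ?G"
    using mem[of "init a"] mem[of "mid a"] a admissible_init admissible_mid
      Poly_Mapping.keys_add[of "frag_of (dual_class (init a))" "frag_of (dual_class (mid a))"] by auto
  show "init_lin (delta_witness (frag_of (dual_class a))) =
        delta_witness (frag_of (dual_class (init a)) + frag_of (dual_class (mid a)) + frag_of (dual_class (fin a)))"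
    using a mem mem2
    by (simp only: add delta_witness_of admissible_init admissible_mid admissible_fin
        delta_rec.simps[of a] init_complete if_True simp_thms)
qed

lemma is_delta_basis:
  assumes d: "is_delta d" shows "admissible a \<Longrightarrow> d (frag_of (dual_class a)) = delta_rec a"
proof (induction "weight a" arbitrary: a rule: less_induct)
  case less
  let ?G = "free_Abelian_group adm_classes"
  show ?case
  proof (cases "a = []")
    case True then show ?thesis using d by (simp add: is_delta_def delta_rec.simps)
  next
    case False
    have add: "d (x + y) = d x + d y" if "x \<in> carrier ?G" "y \<in> carrier ?G" for x y
      using d hom_mult[of d ?G "free_Abelian_group adm_comps" x y] that by (simp add: is_delta_def)
    have mem: "frag_of (dual_class b) \<in> carrier ?G" if "admissible b" for b
      using that by (simp add: dual_class_mem)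
    have mem2: "frag_of (dual_class (init a)) + frag_of (dual_class (mid a)) \<in> carrier ?G"
      using mem[of "init a"] mem[of "mid a"] less.prems admissible_init admissible_mid
        Poly_Mapping.keys_add[of "frag_of (dual_class (init a))" "frag_of (dual_class (mid a))"] by auto
    have "init_lin (d (frag_of (dual_class a))) =
        d (frag_of (dual_class (init a)) + frag_of (dual_class (mid a)) + frag_of (dual_class (fin a)))"
      using d less.prems False by (simp add: is_delta_def)
    also have "\<dots> = d (frag_of (dual_class (init a))) + d (frag_of (dual_class (mid a)))
        + d (frag_of (dual_class (fin a)))"
      using mem mem2 less.prems by (simp only: add admissible_init admissible_mid admissible_fin)
    also have "\<dots> = delta_rec (init a) + delta_rec (mid a) + delta_rec (fin a)"
      using less.hyps[OF weight_init[OF less.prems False] admissible_init[OF less.prems]]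
          less.hyps[OF weight_mid[OF less.prems False] admissible_mid[OF less.prems]]
          less.hyps[OF weight_fin[OF less.prems False] admissible_fin[OF less.prems]] by simp
    finally have i: "init_lin (d (frag_of (dual_class a))) =
      delta_rec (init a) + delta_rec (mid a) + delta_rec (fin a)" .
    have "frag_of (dual_class a) \<in> carrier (free_Abelian_group (adm_classes_wt (weight a)))"
      using less.prems by (simp add: adm_classes_wt_def adm_comps_wt_def adm_comps_def)
    then have "d (frag_of (dual_class a)) \<in> carrier (free_Abelian_group (adm_comps_wt (weight a)))"
      using d unfolding is_delta_def by blast
    then have "complete_lin (weight a) (init_lin (d (frag_of (dual_class a)))) = d (frag_of (dual_class a))"
      using weight_ge_2[OF less.prems False] by (intro complete_init) (simp, linarith)
    then show ?thesis using i less.prems False by (simp add: delta_rec.simps[of a])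
  qed
qed

lemma is_delta_unique:
  assumes d: "is_delta d" and e: "is_delta e" shows "d = e"
proof (rule extensionalityI)
  let ?G = "free_Abelian_group adm_classes"
  let ?H = "free_Abelian_group adm_comps"
  show "d \<in> extensional (carrier ?G)" "e \<in> extensional (carrier ?G)"
    using d e by (auto simp: is_delta_def)
  fix x assume "x \<in> carrier ?G"
  then have "Poly_Mapping.keys x \<subseteq> adm_classes" by simp
  then have "x \<in> carrier ?G \<and> d x = e x"
  proof (induction x rule: frag_induction)
    case zero
    have "group_hom ?G ?H d" "group_hom ?G ?H e"
      using d e by (auto simp: is_delta_def group_hom_def group_hom_axioms_def)
    then show ?case using group_hom.hom_one[of ?G ?H d] group_hom.hom_one[of ?G ?H e] by simp
  next
    case (one X)
    then obtain a where "admissible a" "X = dual_class a"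
      by (auto simp: adm_classes_def adm_comps_def)
    then show ?case using is_delta_basis[OF d] is_delta_basis[OF e] one by simp
  next
    case (diff x y)
    have hom: "f (x - y) = f x - f y" if "is_delta f" for f
    proof -
      have m: "x - y \<in> carrier ?G" using diff keys_diff[of x y] by auto
      have "f ((x - y) + y) = f (x - y) + f y"
        using that hom_mult[of f ?G ?H "x - y" y] diff m by (simp add: is_delta_def)
      then show ?thesis by (simp add: algebra_simps)
    qed
    show ?case using diff hom[OF d] hom[OF e] keys_diff[of x y] by auto
  qed
  then show "d x = e x" by simp
qed

theorem is_delta_ex1: "\<exists>!d. is_delta d"
  using is_delta_witness is_delta_unique by blast

corollary is_delta_delta: "is_delta delta"
  unfolding delta_def by (rule theI'[OF is_delta_ex1])

end

theory Submission
  imports Defs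
begin

text \<open>An element of weight \<open>k\<close> is determined by its image under \<open>init\<close>, so it suffices that the sum
  over the cuts of the word satisfies the recursion defining \<open>delta\<close>. The last entry of a stuffling
  comes from the left factor, from the right factor or from both; hence \<open>init\<close> of a modified stuffle
  product has three terms, in which the left, the right or both factors lose their last entry
  (a factor of depth one cannot lose it), and equals \<open>[]\<close> if both factors have depth one. Shortening
  the right, left or both parts of the cuts of \<open>a\<close> gives precisely the cuts of \<open>init a\<close>, \<open>fin a\<close> and
  \<open>mid a\<close>, with unchanged coefficients. The cuts with both parts of depth one account for those of
  the three compositions that are empty.\<close>

section \<open>Recursion for the stuffle product\<close>

lemma stufflingsD:
  assumes "(t, I, J) \<in> stufflings r s"
  shows "finite I" "finite J" "I \<subseteq> {1..t}" "J \<subseteq> {1..t}" "Suc t \<notin> I" "Suc t \<notin> J"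
    "card I = r" "card J = s" "I \<union> J = {1..t}"
proof -
  have *: "I \<union> J = {1..t}" using assms by (simp add: stufflings_def)
  then show I: "I \<subseteq> {1..t}" and J: "J \<subseteq> {1..t}" by auto
  then show "finite I" "finite J" using finite_subset by blast+
  show "Suc t \<notin> I" "Suc t \<notin> J" using I J by auto
  show "card I = r" "card J = s" "I \<union> J = {1..t}" using assms by (auto simp: stufflings_def)
qed

lemma stufflings_0_left: "stufflings 0 s = {(s, {}, {1..s})}"
proof -
  have "t = s \<and> I = {} \<and> J = {1..s}" if "(t, I, J) \<in> stufflings 0 s" for t I J
    using stufflingsD[OF that] by auto
  then have "p = (s, {}, {1..s})" if "p \<in> stufflings 0 s" for p
    using that by (cases p) blast
  moreover have "(s, {}, {1..s}) \<in> stufflings 0 s" by (simp add: stufflings_def)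
  ultimately show ?thesis by blast
qed

lemma stufflings_0_right: "stufflings r 0 = {(r, {1..r}, {})}"
proof -
  have "t = r \<and> I = {1..r} \<and> J = {}" if "(t, I, J) \<in> stufflings r 0" for t I J
    using stufflingsD[OF that] by auto
  then have "p = (r, {1..r}, {})" if "p \<in> stufflings r 0" for p
    using that by (cases p) blast
  moreover have "(r, {1..r}, {}) \<in> stufflings r 0" by (simp add: stufflings_def)
  ultimately show ?thesis by blast
qed

section \<open>Stufflings built by appending a last position\<close>

definition snoc_left :: "nat \<times> nat set \<times> nat set \<Rightarrow> nat \<times> nat set \<times> nat set" where
  "snoc_left = (\<lambda>(t, I, J). (Suc t, insert (Suc t) I, J))"

definition snoc_right :: "nat \<times> nat set \<times> nat set \<Rightarrow> nat \<times> nat set \<times> nat set" where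
  "snoc_right = (\<lambda>(t, I, J). (Suc t, I, insert (Suc t) J))"

definition snoc_both :: "nat \<times> nat set \<times> nat set \<Rightarrow> nat \<times> nat set \<times> nat set" where
  "snoc_both = (\<lambda>(t, I, J). (Suc t, insert (Suc t) I, insert (Suc t) J))"

text \<open>A stuffling of two positive lengths has a last position, and this position lies in the
  first set only, in the second only, or in both. Deleting it leaves a stuffling of the shortened
  lengths.\<close>

lemma stufflings_Suc_Suc:
  "stufflings (Suc r) (Suc s) = snoc_left ` stufflings r (Suc s) \<union>
     snoc_right ` stufflings (Suc r) s \<union> snoc_both ` stufflings r s" (is "?L = ?R")
proof (intro subset_antisym subsetI)
  fix p assume "p \<in> ?L"
  then obtain t I J where p: "p = (t, I, J)" and m: "(t, I, J) \<in> stufflings (Suc r) (Suc s)"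
    by (cases p) auto
  note D = stufflingsD[OF m]
  have "t \<noteq> 0" using D(3,7) by (intro notI) simp
  then obtain n where t: "t = Suc n" by (cases t) auto
  have U: "(I - {t}) \<union> (J - {t}) = {1..n}"
  proof -
    have "(I - {t}) \<union> (J - {t}) = {1..t} - {t}" using D(9) by blast
    also have "\<dots> = {1..n}" by (auto simp: t)
    finally show ?thesis .
  qed
  have "t \<in> I \<union> J" unfolding D(9) by (simp add: t)
  then consider "t \<in> I" "t \<notin> J" | "t \<notin> I" "t \<in> J" | "t \<in> I" "t \<in> J" by blast
  then show "p \<in> ?R"
  proof cases
    case 1
    have "(n, I - {t}, J) \<in> stufflings r (Suc s)" using U D 1 by (simp add: stufflings_def)
    moreover have "p = snoc_left (n, I - {t}, J)" using 1 by (auto simp: p t snoc_left_def)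
    ultimately show ?thesis by blast
  next
    case 2
    have "(n, I, J - {t}) \<in> stufflings (Suc r) s" using U D 2 by (simp add: stufflings_def)
    moreover have "p = snoc_right (n, I, J - {t})" using 2 by (auto simp: p t snoc_right_def)
    ultimately show ?thesis by blast
  next
    case 3
    have "(n, I - {t}, J - {t}) \<in> stufflings r s" using U D 3 by (simp add: stufflings_def)
    moreover have "p = snoc_both (n, I - {t}, J - {t})" using 3 by (auto simp: p t snoc_both_def)
    ultimately show ?thesis by blast
  qed
next
  fix p assume "p \<in> ?R"
  then consider q where "q \<in> stufflings r (Suc s)" "p = snoc_left q"
    | q where "q \<in> stufflings (Suc r) s" "p = snoc_right q"
    | q where "q \<in> stufflings r s" "p = snoc_both q" by blast
  then obtain t I J where m:
      "(t, I, J) \<in> stufflings r (Suc s) \<and> p = (Suc t, insert (Suc t) I, J)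
      \<or> (t, I, J) \<in> stufflings (Suc r) s \<and> p = (Suc t, I, insert (Suc t) J)
      \<or> (t, I, J) \<in> stufflings r s \<and> p = (Suc t, insert (Suc t) I, insert (Suc t) J)"
    unfolding snoc_left_def snoc_right_def snoc_both_def by cases (auto split: prod.splits)
  have ins: "{1..Suc t} = insert (Suc t) {1..t}" by auto
  from m show "p \<in> ?L"
  proof (elim disjE conjE)
    assume q: "(t, I, J) \<in> stufflings r (Suc s)" "p = (Suc t, insert (Suc t) I, J)"
    show ?thesis using stufflingsD[OF q(1)] by (simp add: stufflings_def q(2) ins del: One_nat_def)
  next
    assume q: "(t, I, J) \<in> stufflings (Suc r) s" "p = (Suc t, I, insert (Suc t) J)"
    show ?thesis using stufflingsD[OF q(1)] by (simp add: stufflings_def q(2) ins del: One_nat_def)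
  next
    assume q: "(t, I, J) \<in> stufflings r s" "p = (Suc t, insert (Suc t) I, insert (Suc t) J)"
    show ?thesis using stufflingsD[OF q(1)] by (simp add: stufflings_def q(2) ins del: One_nat_def)
  qed
qed

lemma inj_on_snoc:
  "inj_on snoc_left (stufflings r s)" "inj_on snoc_right (stufflings r s)"
  "inj_on snoc_both (stufflings r s)"
proof -
  \<comment> \<open>One left inverse serves all three maps: it deletes the last position from both
    sets, and a stuffling on \<open>{1..t}\<close> does not contain \<open>Suc t\<close>, so nothing
    else is lost.\<close>
  let ?g = "\<lambda>(t, I, J). (t - 1, I - {t}, J - {t})"
  have "?g (snoc_left p) = p" "?g (snoc_right p) = p" "?g (snoc_both p) = p"
    if "p \<in> stufflings r s" for p
    using that stufflingsD(5,6)[of "fst p" "fst (snd p)" "snd (snd p)" r s]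
    by (simp_all add: snoc_left_def snoc_right_def snoc_both_def split_beta)
  then show "inj_on snoc_left (stufflings r s)" "inj_on snoc_right (stufflings r s)"
    "inj_on snoc_both (stufflings r s)"
    by (auto intro!: inj_on_inverseI[where g = ?g])
qed

text \<open>The images are told apart by which of the two sets contain the last position
  \<open>fst q\<close>.\<close>

lemma snoc_images_disjoint:
  "snoc_left ` stufflings r s \<inter> snoc_right ` stufflings r' s' = {}"
  "(snoc_left ` stufflings r s \<union> snoc_right ` stufflings r' s') \<inter> snoc_both ` stufflings r'' s'' = {}"
proof -
  have l: "fst q \<in> fst (snd q) \<and> fst q \<notin> snd (snd q)" if "q \<in> snoc_left ` stufflings r s" for q
    using that by (auto simp: snoc_left_def stufflingsD(6))
  have r: "fst q \<notin> fst (snd q)" if "q \<in> snoc_right ` stufflings r' s'" for q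
    using that by (auto simp: snoc_right_def stufflingsD(5))
  have b: "fst q \<in> fst (snd q) \<and> fst q \<in> snd (snd q)" if "q \<in> snoc_both ` stufflings r'' s''" for q
    using that by (auto simp: snoc_both_def)
  show "snoc_left ` stufflings r s \<inter> snoc_right ` stufflings r' s' = {}"
    "(snoc_left ` stufflings r s \<union> snoc_right ` stufflings r' s') \<inter> snoc_both ` stufflings r'' s'' = {}"
    using l r b by blast+
qed

lemma rank_insert_Suc:
  "i \<le> t \<Longrightarrow> rank (insert (Suc t) I) i = rank I i"
  unfolding rank_def by (rule arg_cong[where f = card]) auto

lemma rank_insert_last:
  assumes "I \<subseteq> {1..t}"
  shows "rank (insert (Suc t) I) (Suc t) = Suc (card I)"
proof -
  have "{j \<in> insert (Suc t) I. j \<le> Suc t} = insert (Suc t) I" using assms by auto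
  moreover have "finite I" "Suc t \<notin> I" using assms finite_subset by auto
  ultimately show ?thesis by (simp add: rank_def)
qed

lemma rank_pred_less:
  assumes "finite I" "i \<in> I"
  shows "rank I i - Suc 0 < card I"
  using bij_betwE[OF rank_bij_betw[OF assms(1)]] assms(2) by fastforce

text \<open>The new position exceeds all others, so it leaves their ranks unchanged and itself
  receives the largest rank, which selects the appended entry.\<close>

lemma stuffled_snoc:
  "p \<in> stufflings (length a) (length b) \<Longrightarrow>
     stuffled (a @ [x]) b (snoc_left p) = stuffled a b p @ [x]"
  "p \<in> stufflings (length a) (length b) \<Longrightarrow>
     stuffled a (b @ [y]) (snoc_right p) = stuffled a b p @ [y]"
  "p \<in> stufflings (length a) (length b) \<Longrightarrow>
     stuffled (a @ [x]) (b @ [y]) (snoc_both p) = stuffled a b p @ [x + y]"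
proof -
  assume p: "p \<in> stufflings (length a) (length b)"
  obtain t I J where tIJ: "p = (t, I, J)" by (cases p)
  note D = stufflingsD[OF p[unfolded tIJ]]
  have upt: "[1..<Suc (Suc t)] = [1..<Suc t] @ [Suc t]" by simp
  note rank_simps = rank_insert_Suc rank_insert_last[OF D(3)] rank_insert_last[OF D(4)] D(5-8)
  \<comment> \<open>Positions outside \<open>I\<close> fall into the default branch of
    \<open>stuffled\<close>, which reads from \<open>b\<close>; the index is within \<open>b\<close>
    only because such positions lie in \<open>J\<close>.\<close>
  have IJ: "i \<in> J" if "i \<notin> I" "1 \<le> i" "i \<le> t" for i
    using that D(9) by (metis UnE atLeastAtMost_iff)
  have ra: "(a @ [x]) ! (rank I i - 1) = a ! (rank I i - 1)" if "i \<in> I" for i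
    using rank_pred_less[OF D(1) that] by (simp add: nth_append D)
  have rb: "(b @ [y]) ! (rank J i - 1) = b ! (rank J i - 1)" if "i \<in> J" for i
    using rank_pred_less[OF D(2) that] by (simp add: nth_append D)
  show "stuffled (a @ [x]) b (snoc_left p) = stuffled a b p @ [x]"
    unfolding tIJ snoc_left_def stuffled_def prod.case upt map_append
    by (intro arg_cong2[where f = append] map_cong) (auto simp: rank_simps ra[simplified])
  show "stuffled a (b @ [y]) (snoc_right p) = stuffled a b p @ [y]"
    unfolding tIJ snoc_right_def stuffled_def prod.case upt map_append
    by (intro arg_cong2[where f = append] map_cong)
      (auto simp: rank_simps rb[simplified] IJ)
  show "stuffled (a @ [x]) (b @ [y]) (snoc_both p) = stuffled a b p @ [x + y]"
    unfolding tIJ snoc_both_def stuffled_def prod.case upt map_append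
    by (intro arg_cong2[where f = append] map_cong)
      (auto simp: rank_simps ra[simplified] rb[simplified] IJ)
qed

lemma rank_atLeastAtMost: "i \<le> n \<Longrightarrow> rank {1..n} i = i"
proof -
  assume "i \<le> n"
  then have "{j \<in> {1..n}. j \<le> i} = {1..i}" by auto
  then show ?thesis by (simp add: rank_def)
qed

lemma stuffle_Nil_left [simp]: "stuffle [] b = frag_of b"
proof -
  have "stuffled [] b (length b, {}, {1..length b}) = b"
    by (rule nth_equalityI) (auto simp: stuffled_def rank_atLeastAtMost[simplified] simp del: upt_Suc)
  then show ?thesis by (simp add: stuffle_def stufflings_0_left)
qed

lemma stuffle_Nil_right [simp]: "stuffle a [] = frag_of a"
proof -
  have "stuffled a [] (length a, {1..length a}, {}) = a"
    by (rule nth_equalityI) (auto simp: stuffled_def rank_atLeastAtMost[simplified] simp del: upt_Suc)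
  then show ?thesis by (simp add: stuffle_def stufflings_0_right)
qed

definition snoc_lin :: "nat \<Rightarrow> (nat list \<Rightarrow>\<^sub>0 int) \<Rightarrow> (nat list \<Rightarrow>\<^sub>0 int)" where
  "snoc_lin x = frag_extend (\<lambda>c. frag_of (c @ [x]))"

lemma snoc_lin_sum_frag_of:
  "finite S \<Longrightarrow> snoc_lin x (\<Sum>p\<in>S. frag_of (f p)) = (\<Sum>p\<in>S. frag_of (f p @ [x]))"
  by (simp add: snoc_lin_def frag_extend_sum)

text \<open>The quasi-shuffle recursion, taken at the right end because \<open>delta\<close> is
  characterised through \<open>init\<close>.\<close>

lemma stuffle_snoc_snoc:
  "stuffle (a @ [x]) (b @ [y]) =
     snoc_lin x (stuffle a (b @ [y])) + snoc_lin y (stuffle (a @ [x]) b)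
     + snoc_lin (x + y) (stuffle a b)"
proof -
  let ?f = "\<lambda>p. frag_of (stuffled (a @ [x]) (b @ [y]) p)"
  let ?r = "length a" let ?s = "length b"
  have "stuffle (a @ [x]) (b @ [y]) = sum ?f (stufflings (Suc ?r) (Suc ?s))"
    by (simp add: stuffle_def)
  also have "\<dots> = sum ?f (snoc_left ` stufflings ?r (Suc ?s)) +
      sum ?f (snoc_right ` stufflings (Suc ?r) ?s) + sum ?f (snoc_both ` stufflings ?r ?s)"
    unfolding stufflings_Suc_Suc
    by (simp add: sum.union_disjoint snoc_images_disjoint finite_stufflings)
  also have "sum ?f (snoc_left ` stufflings ?r (Suc ?s)) = snoc_lin x (stuffle a (b @ [y]))"
    by (simp add: sum.reindex inj_on_snoc stuffle_def snoc_lin_sum_frag_of finite_stufflings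
        stuffled_snoc(1))
  also have "sum ?f (snoc_right ` stufflings (Suc ?r) ?s) = snoc_lin y (stuffle (a @ [x]) b)"
    by (simp add: sum.reindex inj_on_snoc stuffle_def snoc_lin_sum_frag_of finite_stufflings
        stuffled_snoc(2))
  also have "sum ?f (snoc_both ` stufflings ?r ?s) = snoc_lin (x + y) (stuffle a b)"
    by (simp add: sum.reindex inj_on_snoc stuffle_def snoc_lin_sum_frag_of finite_stufflings
        stuffled_snoc(3))
  finally show ?thesis .
qed

section \<open>Weight and admissibility of the terms of the products\<close>

lemma keys_snoc_lin:
  "c \<in> Poly_Mapping.keys (snoc_lin x f) \<Longrightarrow> \<exists>d\<in>Poly_Mapping.keys f. c = d @ [x]"
  using keys_frag_extend[of "\<lambda>c. frag_of (c @ [x])" f] by (auto simp: snoc_lin_def)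

lemma keys_stuffle:
  assumes "composition a" "composition b" "c \<in> Poly_Mapping.keys (stuffle a b)"
  shows "composition c \<and> weight c = weight a + weight b"
  using assms
proof (induction "length a + length b" arbitrary: a b c rule: less_induct)
  case less
  show ?case
  proof (cases "a = [] \<or> b = []")
    case True
    then show ?thesis using less.prems by auto
  next
    case False
    then obtain a' x b' y where ab: "a = a' @ [x]" "b = b' @ [y]" by (metis rev_exhaust)
    have "c \<in> Poly_Mapping.keys (snoc_lin x (stuffle a' b)) \<union>
        Poly_Mapping.keys (snoc_lin y (stuffle a b')) \<union>
        Poly_Mapping.keys (snoc_lin (x + y) (stuffle a' b'))"
      using less.prems(3) unfolding ab stuffle_snoc_snoc
      by (meson Poly_Mapping.keys_add UnE UnI1 UnI2 subsetD)
    then consider d where "d \<in> Poly_Mapping.keys (stuffle a' b)" "c = d @ [x]"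
      | d where "d \<in> Poly_Mapping.keys (stuffle a b')" "c = d @ [y]"
      | d where "d \<in> Poly_Mapping.keys (stuffle a' b')" "c = d @ [x + y]"
      using keys_snoc_lin by blast
    then show ?thesis
    proof cases
      case 1
      then show ?thesis using less.prems(1,2) less.hyps[of a' b d] by (simp add: ab)
    next
      case 2
      then show ?thesis using less.prems(1,2) less.hyps[of a b' d] by (simp add: ab)
    next
      case 3
      then show ?thesis using less.prems(1,2) less.hyps[of a' b' d] by (simp add: ab)
    qed
  qed
qed

text \<open>Admissibility comes from the first entry, a sum of two positive integers and hence at
  least 2.\<close>

lemma keys_box_stuffle_basis:
  assumes "composition a" "composition b" "a \<noteq> []" "b \<noteq> []"
  shows "Poly_Mapping.keys (box_stuffle_basis a b) \<subseteq> adm_comps_wt (weight a + weight b)"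
proof
  fix c assume "c \<in> Poly_Mapping.keys (box_stuffle_basis a b)"
  then obtain d where d: "d \<in> Poly_Mapping.keys (stuffle (tl a) (tl b))" "c = (hd a + hd b) # d"
    using keys_frag_extend[of "\<lambda>c. frag_of ((hd a + hd b) # c)" "stuffle (tl a) (tl b)"]
    by (auto simp: box_stuffle_basis_def)
  obtain p a' q b' where ab: "a = p # a'" "b = q # b'" using assms by (metis list.exhaust)
  show "c \<in> adm_comps_wt (weight a + weight b)"
    using keys_stuffle[of a' b' d] d assms
    by (auto simp: ab adm_comps_wt_def adm_comps_def admissible_def)
qed

section \<open>Modified stuffle products under \<open>init\<close>\<close>

lemma init_lin_cons_snoc_lin:
  "init_lin (frag_extend (\<lambda>c. frag_of (p # c)) (snoc_lin x f)) =
     frag_extend (\<lambda>c. frag_of (p # c)) f"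
  by (simp add: init_lin_def snoc_lin_def frag_extend_compose_of)

lemma init_lin_box_stuffle_basis:
  assumes "a \<noteq> []" "b \<noteq> []"
  shows "init_lin (box_stuffle_basis a b) =
    (if tl b = [] then 0 else box_stuffle_basis a (init b)) +
    (if tl a = [] then 0 else box_stuffle_basis (init a) b) +
    (if tl a = [] \<or> tl b = [] then 0 else box_stuffle_basis (init a) (init b)) +
    (if tl a = [] \<and> tl b = [] then frag_of [] else 0)"
proof -
  obtain p a' q b' where ab: "a = p # a'" "b = q # b'" using assms by (metis list.exhaust)
  have lin: "init_lin (f + g) = init_lin f + init_lin g" for f g
    by (simp add: init_lin_def frag_extend_add)
  show ?thesis
  proof (cases "a' = [] \<or> b' = []")
    case True
    \<comment> \<open>With one tail empty, the stuffle of the tails is the other tail, and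
      \<open>init\<close> shortens that one. With both empty, a single entry remains and
      \<open>init\<close> yields \<open>[]\<close>.\<close>
    then show ?thesis by (auto simp: ab box_stuffle_basis_def init_lin_def)
  next
    case False
    then obtain a'' x b'' y where "a' = a'' @ [x]" "b' = b'' @ [y]" by (metis rev_exhaust)
    then show ?thesis
      by (simp add: ab box_stuffle_basis_def stuffle_snoc_snoc frag_extend_add lin
          init_lin_cons_snoc_lin butlast_append)
  qed
qed

section \<open>Cuts of a binary word\<close>

text \<open>The factor coming from the letters before the cut. If \<open>w\<close> starts with 0 and
  \<open>i\<close> is positive, the reversed and complemented prefix ends in 1, so it is the word of
  a composition.\<close>

definition left_part :: "nat \<Rightarrow> bool list \<Rightarrow> nat list" where
  "left_part i w = comp_of_word (dual_word (take i w))"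

definition right_part :: "nat \<Rightarrow> bool list \<Rightarrow> nat list" where
  "right_part i w = comp_of_word (drop i w)"

text \<open>Lists are indexed from 0, so \<open>w ! (i - 1)\<close> and \<open>w ! i\<close> are the
  letters just before and just after the cut.\<close>

definition cut_coeff :: "nat \<Rightarrow> bool list \<Rightarrow> int" where
  "cut_coeff i w = 1 + of_bool (\<not> w ! (i - 1)) + of_bool (w ! i)"

definition cut_sum :: "bool list \<Rightarrow> (nat list \<Rightarrow>\<^sub>0 int)" where
  "cut_sum w = (\<Sum>i = 1..length w - 1.
     frag_cmul (cut_coeff i w) (box_stuffle_basis (left_part i w) (right_part i w)))"

lemma length_dual_word [simp]: "length (dual_word w) = length w"
  by (simp add: dual_word_def)

lemma comp_of_word_Nil [simp]: "comp_of_word [] = []"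
  using comp_of_word_word[of "[]"] by simp

lemma comp_of_word_eq_Nil: "u = [] \<or> last u \<Longrightarrow> comp_of_word u = [] \<longleftrightarrow> u = []"
  using comp_of_word(2)[of u] by fastforce

lemma comp_of_word_snoc:
  assumes "x = [] \<or> last x"
  shows "comp_of_word (x @ replicate m False @ [True]) = comp_of_word x @ [Suc m]"
  using comp_of_word_word[of "comp_of_word x @ [Suc m]"] comp_of_word[OF assms] by simp

text \<open>The final block of \<open>m\<close> zeros and a 1 encodes the last entry. A cut before
  the block keeps this entry whole, with others in front of it; a cut at its start or inside it
  leaves a single entry.\<close>

lemma right_part_snoc:
  assumes w: "w = u @ replicate m False @ [True]" and u: "u = [] \<or> last u"
  shows "i < length u \<Longrightarrow> right_part i w = right_part i u @ [Suc m]"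
    and "i < length u \<Longrightarrow> right_part i u \<noteq> []"
    and "length u \<le> i \<Longrightarrow> i < length w \<Longrightarrow> right_part i w = [length w - i]"
proof -
  assume i: "i < length u"
  then have d: "drop i u = [] \<or> last (drop i u)" using u by auto
  show "right_part i w = right_part i u @ [Suc m]"
    using comp_of_word_snoc[OF d, of m] i by (simp add: right_part_def w)
  show "right_part i u \<noteq> []"
    using comp_of_word_eq_Nil[OF d] i by (simp add: right_part_def)
next
  assume i: "length u \<le> i" "i < length w"
  then have "drop i w = [] @ replicate (m - (i - length u)) False @ [True]" by (simp add: w)
  then have "right_part i w = [] @ [Suc (m - (i - length u))]"
    unfolding right_part_def using comp_of_word_snoc[of "[]" "m - (i - length u)"] by simp
  then show "right_part i w = [length w - i]" using i by (simp add: w)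
qed

lemma left_part_eq_right_part:
  "left_part i w = right_part (length w - i) (dual_word w)"
  by (simp add: left_part_def right_part_def dual_word_def rev_take drop_map flip: take_map)

text \<open>Mirror image of \<open>right_part_snoc\<close>: the initial block, a 0 followed by
  \<open>n\<close> ones, becomes the final block of the dual word. The condition on \<open>v\<close>
  says that the run of ones is maximal.\<close>

lemma left_part_cons:
  assumes w: "w = False # replicate n True @ v" and v: "v = [] \<or> \<not> hd v"
  shows "0 < j \<Longrightarrow> j \<le> length v \<Longrightarrow> left_part (j + Suc n) w = left_part j v @ [Suc n]"
    and "0 < j \<Longrightarrow> j \<le> length v \<Longrightarrow> left_part j v \<noteq> []"
    and "0 < i \<Longrightarrow> i \<le> Suc n \<Longrightarrow> left_part i w = [i]"
proof -
  have dw: "dual_word w = dual_word v @ replicate n False @ [True]"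
    by (simp add: w dual_word_def)
  have dv: "dual_word v = [] \<or> last (dual_word v)"
    using v by (cases "v = []") (simp_all add: dual_word_def last_rev hd_map)
  note * = right_part_snoc[OF dw dv]
  {
    assume j: "0 < j" "j \<le> length v"
    show "left_part (j + Suc n) w = left_part j v @ [Suc n]"
      using *(1)[of "length v - j"] j by (simp add: left_part_eq_right_part w)
    show "left_part j v \<noteq> []"
      using *(2)[of "length v - j"] j by (simp add: left_part_eq_right_part)
  next
    assume i: "0 < i" "i \<le> Suc n"
    show "left_part i w = [i]"
      using *(3)[of "length w - i"] i by (simp add: left_part_eq_right_part w)
  }
qed

section \<open>Removing the final or the initial block of a word\<close>

lemma init_word_decomp:
  assumes "w \<noteq> []" "last w"
  obtains m where "w = init_word w @ replicate m False @ [True]" "init_word w = [] \<or> last (init_word w)"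
proof -
  obtain c where c: "composition c" "word c = w" using word_surj[of w] assms by blast
  then obtain b p where bp: "c = b @ [p]" using assms by (metis rev_exhaust word_eq_Nil)
  have b: "init_word w = word b" using word_init[of c] by (metis bp butlast_snoc c(2))
  have "w = word b @ replicate (p - 1) False @ [True]" using c(2) by (simp add: bp)
  moreover have "word b = [] \<or> last (word b)" using last_word[of b] by auto
  ultimately show thesis using that[of "p - 1"] unfolding b by blast
qed

lemma fin_word_decomp:
  assumes "w \<noteq> []" "\<not> hd w"
  obtains n where "w = False # replicate n True @ fin_word w" "fin_word w = [] \<or> \<not> hd (fin_word w)"
proof -
  obtain v where w: "w = False # v" using assms by (cases w) auto
  have tw: "takeWhile (\<lambda>e. e) v = replicate (length (takeWhile (\<lambda>e. e) v)) True"
    by (induction v) auto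
  have "w = False # replicate (length (takeWhile (\<lambda>e. e) v)) True @ fin_word w"
    unfolding tw[symmetric] by (simp add: w fin_word_def)
  moreover have "fin_word w = [] \<or> \<not> hd (fin_word w)"
    unfolding fin_word_def using hd_dropWhile[of "\<lambda>e. e"] by blast
  ultimately show thesis by (rule that)
qed

text \<open>Shortening the right part of a cut before the final block gives the cut of
  \<open>init_word w\<close> at the same place, with the same adjacent letters. The other cuts have
  a right part of depth one and drop out.\<close>

lemma sum_init_right_part:
  assumes "w = [] \<or> last w"
  shows "(\<Sum>i = 1..length w - 1. frag_cmul (cut_coeff i w)
      (if tl (right_part i w) = [] then 0
       else box_stuffle_basis (left_part i w) (init (right_part i w)))) = cut_sum (init_word w)"
proof (cases "w = []")
  case True
  then show ?thesis by (simp add: cut_sum_def init_word_def)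
next
  case False
  define u where "u = init_word w"
  obtain m where w: "w = u @ replicate m False @ [True]" and u: "u = [] \<or> last u"
    using init_word_decomp[OF False] assms False u_def by metis
  note rp = right_part_snoc[OF w u]
  have "left_part i w = left_part i u \<and> cut_coeff i w = cut_coeff i u" if "0 < i" "i < length u" for i
    using that by (simp add: w left_part_def cut_coeff_def nth_append less_imp_diff_less)
  then show ?thesis
    unfolding cut_sum_def u_def[symmetric]
    by (intro sum.mono_neutral_cong_right) (auto simp: w rp[unfolded w])
qed

text \<open>Renumbers the cuts when a prefix of length \<open>N\<close> is removed, the cuts within
  or just after it contributing nothing.\<close>

lemma sum_atLeastAtMost_shift:
  fixes F G :: "nat \<Rightarrow> 'a::comm_monoid_add"
  assumes "\<And>i. 0 < i \<Longrightarrow> i \<le> N \<Longrightarrow> F i = 0"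
    and "\<And>j. 0 < j \<Longrightarrow> j < l \<Longrightarrow> F (j + N) = G j"
  shows "(\<Sum>i = 1..N + l - 1. F i) = (\<Sum>j = 1..l - 1. G j)"
proof -
  have "(\<Sum>i = 1..N + l - 1. F i) = (\<Sum>i \<in> (\<lambda>j. j + N) ` {1..l - 1}. F i)"
  proof (rule sum.mono_neutral_right)
    have "i \<in> (\<lambda>j. j + N) ` {1..l - 1}" if "N < i" "i \<le> N + l - 1" for i
      using that by (intro image_eqI[of _ _ "i - N"]) auto
    then show "\<forall>i\<in>{1..N + l - 1} - (\<lambda>j. j + N) ` {1..l - 1}. F i = 0"
      using assms(1) by (metis DiffE One_nat_def Suc_le_eq atLeastAtMost_iff not_le)
  qed auto
  also have "\<dots> = (\<Sum>j = 1..l - 1. F (j + N))" by (simp add: sum.reindex del: image_add_atLeastAtMost')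
  also have "\<dots> = (\<Sum>j = 1..l - 1. G j)" by (rule sum.cong) (auto intro: assms(2))
  finally show ?thesis .
qed

text \<open>Here cuts move by the length \<open>Suc n\<close> of the initial block. The function
  \<open>g\<close> is left arbitrary so that the right part can be kept (for \<open>fin\<close>) or
  shortened as well (for \<open>mid\<close>).\<close>

lemma sum_init_left_part:
  assumes w: "w = False # replicate n True @ v" and v: "v = [] \<or> \<not> hd v"
  shows "(\<Sum>i = 1..length w - 1. frag_cmul (cut_coeff i w)
      (if tl (left_part i w) = [] then 0
       else g (init (left_part i w)) (right_part i w))) =
    (\<Sum>j = 1..length v - 1. frag_cmul (cut_coeff j v) (g (left_part j v) (right_part j v)))"
proof -
  have len: "length w = Suc n + length v" by (simp add: w)
  note lp = left_part_cons[OF w v]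
  \<comment> \<open>Positivity of \<open>j\<close> puts the letter before the cut in
    \<open>v\<close> too, so the coefficient does not see the removed block.\<close>
  have "right_part (j + Suc n) w = right_part j v \<and> cut_coeff (j + Suc n) w = cut_coeff j v"
    if "0 < j" for j
    using that by (cases j) (simp_all add: w right_part_def cut_coeff_def nth_append)
  then show ?thesis
    unfolding len by (intro sum_atLeastAtMost_shift) (simp_all add: lp[unfolded add_Suc_right])
qed

lemma dropWhile_Not_False_replicate_True:
  "rev (dropWhile Not (rev (False # replicate n True))) = (if n = 0 then [] else False # replicate n True)"
  by (cases n) (auto simp: replicate_append_same)

text \<open>The coefficients enter here only: a cut with both parts of depth one exists exactly when one
  of the three smaller words is empty, and its coefficient then counts the empty ones.\<close>

lemma sum_depth_one_cuts:
  assumes w: "w = False # replicate n True @ v" and v: "v = [] \<or> \<not> hd v" and last: "last w"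
  shows "(\<Sum>i = 1..length w - 1.
      if tl (left_part i w) = [] \<and> tl (right_part i w) = [] then cut_coeff i w else 0) =
    of_bool (init_word w = []) + of_bool (init_word v = []) + of_bool (v = [])"
proof -
  define u where "u = init_word w"
  have "w \<noteq> []" by (simp add: w)
  then obtain m where m: "w = u @ replicate m False @ [True]" and u: "u = [] \<or> last u"
    using init_word_decomp last u_def by metis
  have R: "tl (right_part i w) = [] \<longleftrightarrow> length u \<le> i" if "i < length w" for i
    using right_part_snoc[OF m u, of i] that by (cases "length u \<le> i") auto
  have L: "tl (left_part i w) = [] \<longleftrightarrow> i \<le> Suc n" if i: "0 < i" "i < length w" for i
  proof (cases "i \<le> Suc n")
    case True
    then show ?thesis using left_part_cons(3)[OF w v, of i] i by simp
  next
    case False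
    then have "i = (i - Suc n) + Suc n" "0 < i - Suc n" "i - Suc n \<le> length v"
      using i by (auto simp: w)
    then have "left_part i w = left_part (i - Suc n) v @ [Suc n]" "left_part (i - Suc n) v \<noteq> []"
      using left_part_cons(1,2)[OF w v, of "i - Suc n"] by simp_all
    then show ?thesis using False by simp
  qed
  \<comment> \<open>The cuts with both parts of depth one are those that are neither before the
    final block nor beyond the end of the initial block.\<close>
  have S: "(\<Sum>i = 1..length w - 1.
      if tl (left_part i w) = [] \<and> tl (right_part i w) = [] then cut_coeff i w else 0) =
    (\<Sum>i = 1..length w - 1. if i \<le> Suc n \<and> length u \<le> i then cut_coeff i w else 0)"
    by (rule sum.cong) (auto simp: L R)
  show ?thesis
  proof (cases "v = []")
    case True
    then have "n \<noteq> 0" using last by (intro notI) (simp add: w)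
    then obtain p where n: "n = Suc p" by (cases n) auto
    have w': "w = (False # replicate p True) @ [True]"
      by (simp add: w True n replicate_append_same)
    have u': "u = (if p = 0 then [] else False # replicate p True)"
      unfolding u_def w' init_word_append[OF list.simps(3)] dropWhile_Not_False_replicate_True
      by (simp add: init_word_def)
    \<comment> \<open>Here \<open>w\<close> is a 0 followed by \<open>n\<close> ones, and only the
      cut before the last letter qualifies. That letter is 1, and the one before it is 0 exactly
      when \<open>init_word w\<close> is empty.\<close>
    have "(\<Sum>i = 1..length w - 1. if i \<le> Suc n \<and> length u \<le> i then cut_coeff i w else 0) =
        (\<Sum>i = 1..length w - 1. if i = n then cut_coeff i w else 0)"
      by (rule sum.cong) (auto simp: u' n w')
    also have "\<dots> = cut_coeff n w" by (simp add: w' n)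
    also have "\<dots> = 2 + of_bool (p = 0)" by (simp add: cut_coeff_def w' n nth_append nth_Cons')
    finally show ?thesis unfolding S u_def[symmetric] by (simp add: True u' init_word_def)
  next
    case vne: False
    then have lv: "last v" using last by (simp add: w)
    obtain p where p: "v = init_word v @ replicate p False @ [True]"
      using init_word_decomp[OF vne lv] by metis
    have u': "u = (if init_word v = [] then if n = 0 then [] else False # replicate n True
        else False # replicate n True @ init_word v)"
      using init_word_append[OF vne, of "False # replicate n True"]
      unfolding dropWhile_Not_False_replicate_True by (simp add: u_def w)
    show ?thesis
    proof (cases "init_word v = []")
      case True
      then have v': "v = replicate p False @ [True]" using p by simp
      have "p \<noteq> 0" using v by (intro notI) (simp add: v')
      then obtain q where q: "p = Suc q" by (cases p) auto
      \<comment> \<open>Now \<open>v\<close> is itself a single block starting with 0, so the only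
        cut is the one separating the two blocks. Its right letter is 0; its left letter is 0
        exactly when \<open>n = 0\<close>, that is, when \<open>init_word w\<close> is
        empty.\<close>
      have "(\<Sum>i = 1..length w - 1. if i \<le> Suc n \<and> length u \<le> i then cut_coeff i w else 0) =
          (\<Sum>i = 1..length w - 1. if i = Suc n then cut_coeff i w else 0)"
        by (rule sum.cong) (auto simp: u' True)
      also have "\<dots> = cut_coeff (Suc n) w" by (simp add: w v')
      also have "\<dots> = 1 + of_bool (n = 0)"
        by (simp add: cut_coeff_def w v' q nth_append nth_Cons')
      finally show ?thesis unfolding S u_def[symmetric] by (simp add: True u' vne)
    next
      case False
      \<comment> \<open>The final block starts beyond the end of the initial block, so no cut
        qualifies and none of the three words is empty.\<close>
      then have "length u > Suc n" by (simp add: u')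
      then have "(\<Sum>i = 1..length w - 1. if i \<le> Suc n \<and> length u \<le> i then cut_coeff i w else 0) = 0"
        by (intro sum.neutral) auto
      then show ?thesis unfolding S u_def[symmetric] by (simp add: u' False vne)
    qed
  qed
qed

section \<open>The recursion of \<open>delta\<close> for the sum over cuts\<close>

text \<open>The multiple of \<open>frag_of []\<close> compensates for \<open>cut_sum []\<close>
  being 0, whereas \<open>delta\<close> sends the class of the empty composition to
  \<open>frag_of []\<close>.\<close>

lemma init_lin_cut_sum:
  assumes ne: "w \<noteq> []" and hd: "\<not> hd w" and last: "last w"
  shows "init_lin (cut_sum w) =
    cut_sum (init_word w) + cut_sum (init_word (fin_word w)) + cut_sum (fin_word w) +
    frag_cmul (of_bool (init_word w = []) + of_bool (init_word (fin_word w) = [])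
      + of_bool (fin_word w = [])) (frag_of [])"
proof -
  define v where "v = fin_word w"
  obtain n where w: "w = False # replicate n True @ v" and v: "v = [] \<or> \<not> hd v"
    using fin_word_decomp[OF ne hd] v_def by metis
  have lv: "v = [] \<or> last v" using last by (cases "v = []") (simp_all add: w)
  let ?L = "\<lambda>i. left_part i w" and ?R = "\<lambda>i. right_part i w" and ?c = "\<lambda>i. cut_coeff i w"
  let ?I = "{1..length w - 1}"
  have nonempty: "?L i \<noteq> [] \<and> ?R i \<noteq> []" if "i \<in> ?I" for i
  proof -
    have "take i w = [] \<or> \<not> hd (take i w)" "take i w \<noteq> []" using that ne hd by auto
    then have "dual_word (take i w) \<noteq> [] \<and> last (dual_word (take i w))"
      by (simp add: dual_word_def last_rev hd_map)
    moreover have "drop i w \<noteq> [] \<and> last (drop i w)" using that last by auto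
    ultimately show ?thesis
      by (simp add: left_part_def right_part_def comp_of_word_eq_Nil)
  qed
  have fin_part: "(\<Sum>i\<in>?I. frag_cmul (?c i)
      (if tl (?L i) = [] then 0 else box_stuffle_basis (init (?L i)) (?R i))) = cut_sum v"
    using sum_init_left_part[OF w v, of box_stuffle_basis] by (simp only: cut_sum_def)
  \<comment> \<open>Both parts are shortened in turn: first the left one, with a \<open>g\<close>
    that already shortens the right one, which leaves the sum of \<open>sum_init_right_part\<close>
    for \<open>v\<close>.\<close>
  have mid_part: "(\<Sum>i\<in>?I. frag_cmul (?c i) (if tl (?L i) = [] then 0 else if tl (?R i) = [] then 0
      else box_stuffle_basis (init (?L i)) (init (?R i)))) = cut_sum (init_word v)"
    using sum_init_left_part[OF w v, of "\<lambda>a b. if tl b = [] then 0 else box_stuffle_basis a (init b)"]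
      sum_init_right_part[OF lv] by (rule trans)
  have "init_lin (cut_sum w) = (\<Sum>i\<in>?I. frag_cmul (?c i) (init_lin (box_stuffle_basis (?L i) (?R i))))"
    by (simp add: cut_sum_def init_lin_def frag_extend_sum frag_extend_cmul)
  also have "\<dots> = (\<Sum>i\<in>?I.
      frag_cmul (?c i) (if tl (?R i) = [] then 0 else box_stuffle_basis (?L i) (init (?R i))) +
      frag_cmul (?c i) (if tl (?L i) = [] then 0 else box_stuffle_basis (init (?L i)) (?R i)) +
      frag_cmul (?c i) (if tl (?L i) = [] then 0 else if tl (?R i) = [] then 0
        else box_stuffle_basis (init (?L i)) (init (?R i))) +
      frag_cmul (if tl (?L i) = [] \<and> tl (?R i) = [] then ?c i else 0) (frag_of []))"
    by (rule sum.cong)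
      (simp_all only: init_lin_box_stuffle_basis nonempty frag_cmul_distrib2 simp_thms, auto)
  also have "\<dots> = cut_sum (init_word w) + cut_sum v + cut_sum (init_word v) +
      (\<Sum>i\<in>?I. frag_cmul (if tl (?L i) = [] \<and> tl (?R i) = [] then ?c i else 0) (frag_of []))"
    unfolding sum.distrib
    by (simp only: fin_part mid_part sum_init_right_part last simp_thms)
  \<comment> \<open>All these terms are multiples of \<open>frag_of []\<close>, so their integer
    coefficients can be added first.\<close>
  also have "(\<Sum>i\<in>?I. frag_cmul (if tl (?L i) = [] \<and> tl (?R i) = [] then ?c i else 0) (frag_of [])) =
      frag_cmul (\<Sum>i\<in>?I. if tl (?L i) = [] \<and> tl (?R i) = [] then ?c i else 0)
        (frag_of ([] :: nat list))"
    by (rule sum_comp_morphism[unfolded comp_def, where h = "\<lambda>c. frag_cmul c (frag_of [])"])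
      (simp_all add: frag_cmul_distrib)
  finally show ?thesis
    unfolding sum_depth_one_cuts[OF w v last] v_def[symmetric] by (simp only: add_ac)
qed

text \<open>Homogeneity is what allows \<open>cut_sum w\<close> to be recovered from its image under
  \<open>init_lin\<close>: the lost last entry is the missing weight.\<close>

lemma keys_cut_sum:
  assumes "w \<noteq> []" "\<not> hd w" "last w"
  shows "Poly_Mapping.keys (cut_sum w) \<subseteq> adm_comps_wt (length w)"
proof -
  have "Poly_Mapping.keys (box_stuffle_basis (left_part i w) (right_part i w))
      \<subseteq> adm_comps_wt (length w)" if i: "i \<in> {1..length w - 1}" for i
  proof -
    let ?x = "dual_word (take i w)" and ?y = "drop i w"
    have x: "?x \<noteq> []" "last ?x" using i assms by (auto simp: dual_word_def last_rev hd_map)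
    have y: "?y \<noteq> []" "last ?y" using i assms by auto
    have "weight (left_part i w) = i" "weight (right_part i w) = length w - i"
      using comp_of_word[of ?x] comp_of_word[of ?y] x y i
        length_word[of "left_part i w"] length_word[of "right_part i w"]
      by (simp_all add: left_part_def right_part_def)
    moreover have "i + (length w - i) = length w" using i by auto
    ultimately show ?thesis
      using keys_box_stuffle_basis[of "left_part i w" "right_part i w"] x y
      by (simp add: left_part_def right_part_def comp_of_word_eq_Nil comp_of_word(1))
  qed
  then show ?thesis
    unfolding cut_sum_def
    by (intro order_trans[OF keys_sum] UN_least order_trans[OF keys_cmul])
qed

text \<open>Induction on the weight, as \<open>init\<close>, \<open>mid\<close> and
  \<open>fin\<close> all lower it. The correction term makes the formula hold for the empty
  composition, which can occur among these three.\<close>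

lemma delta_rec_eq_cut_sum:
  "admissible a \<Longrightarrow> delta_rec a = cut_sum (word a) + frag_cmul (of_bool (a = [])) (frag_of [])"
proof (induction "weight a" arbitrary: a rule: less_induct)
  case less
  show ?case
  proof (cases "a = []")
    case True
    then show ?thesis by (simp add: delta_rec.simps cut_sum_def)
  next
    case False
    let ?w = "word a"
    have w: "?w \<noteq> []" "\<not> hd ?w" "last ?w"
      using False less.prems last_word by (auto simp: admissible_iff_word)
    have len: "length ?w = weight a" using less.prems by (simp add: length_word admissible_def)
    have words: "word (init a) = init_word ?w" "word (fin a) = fin_word ?w"
        "word (mid a) = init_word (fin_word ?w)"
      using less.prems by (simp_all add: word_init word_fin mid_def)
    have empties: "init a = [] \<longleftrightarrow> init_word ?w = []" "fin a = [] \<longleftrightarrow> fin_word ?w = []"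
        "mid a = [] \<longleftrightarrow> init_word (fin_word ?w) = []"
      using words by (metis word_eq_Nil)+
    have "init_lin (cut_sum ?w) = delta_rec (init a) + delta_rec (mid a) + delta_rec (fin a)"
      using less.hyps[OF weight_init[OF less.prems False] admissible_init[OF less.prems]]
        less.hyps[OF weight_mid[OF less.prems False] admissible_mid[OF less.prems]]
        less.hyps[OF weight_fin[OF less.prems False] admissible_fin[OF less.prems]]
      by (simp only: init_lin_cut_sum[OF w] words empties frag_cmul_distrib add_ac)
    then have "delta_rec a = complete_lin (weight a) (init_lin (cut_sum ?w))"
      using less.prems False by (simp add: delta_rec.simps[of a])
    also have "\<dots> = cut_sum ?w"
      using complete_init keys_cut_sum[OF w] weight_ge_2[OF less.prems False] len by simp
    finally show ?thesis using False by simp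
  qed
qed

theorem theorem16:
  fixes a :: "nat list" and k :: nat and w :: "bool list"
  assumes "admissible a" and "a \<noteq> []" and "weight a = k" and "w = word a"
  shows "delta (frag_of (dual_class a)) =
    (\<Sum>i = 1..k - 1.
       frag_cmul (1 + of_bool (\<not> w ! (i - 1)) + of_bool (w ! i))
         (frag_of (comp_of_word (dual_word (take i w))) \<boxtimes> frag_of (comp_of_word (drop i w))))"
proof -
  have "length w = k" using assms by (simp add: length_word admissible_def)
  \<comment> \<open>The correction term vanishes because \<open>a\<close> is non-empty.\<close>
  have "delta (frag_of (dual_class a)) = cut_sum w"
    using is_delta_basis[OF is_delta_delta assms(1)] delta_rec_eq_cut_sum[OF assms(1)] assms
    by simp
  then show ?thesis
    by (simp add: cut_sum_def \<open>length w = k\<close> cut_coeff_def left_part_def right_part_def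
        box_stuffle_def)
qed

end
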